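(* For positive integers $n$ the following hold, where all counts and sums are over triples $(r,s,t)$ of positive integers: \begin{align*} \#\{(r,s,t): (2s+r)(2t+r)=n+r^2\} &= H(4n)-\sigma_0\!\left(\tfrac{n}{2}\right) &&\text{if } n\equiv 2 \pmod 4,\\ \#\{(r,s,t): (2s-1+r)(2t-1+r)=n+r^2\} &= H(4n)-\tfrac12\sigma_0(n) &&\text{if } n\equiv 1 \pmod 4,\\ \#\{(r,s,t): (2s-1+r)(2t-1+r)=n+r^2\} &= 6H(n)-\tfrac12\sigma_0(n) &&\text{if } n\equiv 3 \pmod 8,\\ \sum_{\substack{r,s,t\ge 1\\(2s-1+r)(2t-1+r)=n+r^2}}(-1)^{r+s+t} &= \tfrac12\sigma_0(n) &&\text{if } n\equiv 7 \pmod 8. \end{align*}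
   Context: $\sigma_0(m)$ denotes the number of positive divisors of $m$. $H(N)$ is the Hurwitz class number: $H(N)=0$ if $N\equiv 1,2\pmod 4$; $H(0)=-1/12$; and for $N>0$ with $N\equiv 0,3\pmod 4$, $H(N)$ is the number of $\mathrm{SL}_2(\mathbb{Z})$-equivalence classes of (not necessarily primitive) positive definite integral binary quadratic forms $ax^2+bxy+cy^2$ of discriminant $b^2-4ac=-N$, where classes of forms equivalent to $a(x^2+y^2)$ are counted with weight $1/2$ and those equivalent to $a(x^2+xy+y^2)$ with weight $1/3$. *)

theory Defs
  imports Complex_Main
begin

text \<open>The triple \<open>(a, b, c)\<close> stands for the binary quadratic form \<open>a x\<^sup>2 + b x y + c y\<^sup>2\<close>.\<close>

type_synonym qform = "int \<times> int \<times> int"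

fun qeval :: "qform \<Rightarrow> 'a::comm_ring_1 \<Rightarrow> 'a \<Rightarrow> 'a" where
  "qeval (a, b, c) x y = of_int a * x^2 + of_int b * x * y + of_int c * y^2"

fun disc :: "qform \<Rightarrow> int" where
  "disc (a, b, c) = b^2 - 4 * a * c"

definition pos_def :: "qform \<Rightarrow> bool" where
  "pos_def f \<longleftrightarrow> (\<forall>x y :: real. (x, y) \<noteq> (0, 0) \<longrightarrow> qeval f x y > 0)"

text \<open>Equivalence under the substitution action of the matrix with rows \<open>(p, q)\<close> and \<open>(u, v)\<close>
  in \<open>SL\<^sub>2(\<int>)\<close>. An integral form is determined by its values at integer points.\<close>

definition sl2_equiv :: "qform \<Rightarrow> qform \<Rightarrow> bool" where
  "sl2_equiv f g \<longleftrightarrow> (\<exists>p q u v :: int. p * v - q * u = 1 \<and>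
     (\<forall>x y :: int. qeval g x y = qeval f (p * x + q * y) (u * x + v * y)))"

definition pd_forms :: "nat \<Rightarrow> qform set" where
  "pd_forms N = {f. pos_def f \<and> disc f = - int N}"

definition form_classes :: "nat \<Rightarrow> qform set set" where
  "form_classes N = pd_forms N // {(f, g). f \<in> pd_forms N \<and> g \<in> pd_forms N \<and> sl2_equiv f g}"

lemma equiv_sl2:
  "equiv (pd_forms N) {(f, g). f \<in> pd_forms N \<and> g \<in> pd_forms N \<and> sl2_equiv f g}"
proof (rule equivI)
  have "sl2_equiv f f" for f
    unfolding sl2_equiv_def
    by (rule exI[of _ 1], rule exI[of _ 0], rule exI[of _ 0], rule exI[of _ 1]) simp
  then show "refl_on (pd_forms N) {(f, g). f \<in> pd_forms N \<and> g \<in> pd_forms N \<and> sl2_equiv f g}"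
    by (auto simp: refl_on_def)
  have "sl2_equiv g f" if "sl2_equiv f g" for f g
  proof -
    from that obtain p q u v :: int where d: "p * v - q * u = 1"
      and e: "\<And>x y :: int. qeval g x y = qeval f (p * x + q * y) (u * x + v * y)"
      unfolding sl2_equiv_def by blast
    have "qeval f x y = qeval g (v * x + (-q) * y) ((-u) * x + p * y)" for x y :: int
    proof -
      have "p * (v * x + (-q) * y) + q * ((-u) * x + p * y) = (p * v - q * u) * x"
        "u * (v * x + (-q) * y) + v * ((-u) * x + p * y) = (p * v - q * u) * y"
        by (simp_all add: algebra_simps)
      with d show ?thesis by (simp only: e mult_1)
    qed
    moreover have "v * p - (-q) * (-u) = 1" using d by (simp add: algebra_simps)
    ultimately show ?thesis unfolding sl2_equiv_def by blast
  qed
  then show "sym {(f, g). f \<in> pd_forms N \<and> g \<in> pd_forms N \<and> sl2_equiv f g}"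
    by (auto simp: sym_def)
  have "sl2_equiv f h" if "sl2_equiv f g" "sl2_equiv g h" for f g h
  proof -
    from that(1) obtain p q u v :: int where d: "p * v - q * u = 1"
      and e: "\<And>x y :: int. qeval g x y = qeval f (p * x + q * y) (u * x + v * y)"
      unfolding sl2_equiv_def by blast
    from that(2) obtain p' q' u' v' :: int where d': "p' * v' - q' * u' = 1"
      and e': "\<And>x y :: int. qeval h x y = qeval g (p' * x + q' * y) (u' * x + v' * y)"
      unfolding sl2_equiv_def by blast
    have "(p*p' + q*u') * (u*q' + v*v') - (p*q' + q*v') * (u*p' + v*u')
        = (p * v - q * u) * (p' * v' - q' * u')"
      by (simp add: algebra_simps)
    then have "(p*p' + q*u') * (u*q' + v*v') - (p*q' + q*v') * (u*p' + v*u') = 1"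
      by (simp add: d d')
    moreover have "qeval h x y = qeval f ((p*p' + q*u') * x + (p*q' + q*v') * y)
        ((u*p' + v*u') * x + (u*q' + v*v') * y)" for x y :: int
      by (simp add: e e' algebra_simps)
    ultimately show ?thesis unfolding sl2_equiv_def by blast
  qed
  then show "trans {(f, g). f \<in> pd_forms N \<and> g \<in> pd_forms N \<and> sl2_equiv f g}"
    unfolding trans_def by blast
qed auto

definition class_weight :: "qform set \<Rightarrow> real" where
  "class_weight C =
     (if \<exists>a. (a, 0, a) \<in> C then 1/2
      else if \<exists>a. (a, a, a) \<in> C then 1/3
      else 1)"

text \<open>By reduction theory there are only finitely many classes for \<open>N > 0\<close>, so the sum is not
  an instance of the default value \<open>0\<close> for infinite index sets.\<close>

definition hurwitz_H :: "nat \<Rightarrow> real" where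
  "hurwitz_H N =
     (if N mod 4 = 1 \<or> N mod 4 = 2 then 0
      else if N = 0 then - 1/12
      else (\<Sum>C\<in>form_classes N. class_weight C))"

text \<open>Only meaningful for \<open>m > 0\<close>: the divisors of \<open>0\<close> form an infinite set.\<close>

definition sigma0 :: "nat \<Rightarrow> nat" where
  "sigma0 m = card {d. d dvd m}"

text \<open>The natural number subtractions below do not truncate, since \<open>s\<close> and \<open>t\<close> are positive.\<close>

definition even_triples :: "nat \<Rightarrow> (nat \<times> nat \<times> nat) set" where
  "even_triples n = {(r, s, t). r > 0 \<and> s > 0 \<and> t > 0 \<and>
     (2 * s + r) * (2 * t + r) = n + r^2}"

definition odd_triples :: "nat \<Rightarrow> (nat \<times> nat \<times> nat) set" where
  "odd_triples n = {(r, s, t). r > 0 \<and> s > 0 \<and> t > 0 \<and>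
     (2 * s - 1 + r) * (2 * t - 1 + r) = n + r^2}"

lemma finite_even_triples: "finite (even_triples n)"
proof (rule finite_subset)
  show "even_triples n \<subseteq> {..n} \<times> {..n} \<times> {..n}"
  proof
    fix x assume "x \<in> even_triples n"
    then obtain r s t where x: "x \<in> even_triples n" "x = (r, s, t)" by (metis prod_cases3)
    then have "(r, s, t) \<in> even_triples n" by simp
    then have h: "r > 0" "s > 0" "t > 0" "4 * (s * t) + 2 * (r * s) + 2 * (r * t) = n"
      by (auto simp: even_triples_def algebra_simps power2_eq_square)
    from h(1-3) have "r * 1 \<le> r * s" "s * 1 \<le> s * t" "1 * t \<le> s * t"
      by (intro mult_le_mono; simp)+
    then have "r \<le> r * s" "s \<le> s * t" "t \<le> s * t" by simp_all
    with h(4) have "r \<le> n" "s \<le> n" "t \<le> n" by linarith+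
    then show "x \<in> {..n} \<times> {..n} \<times> {..n}" using x by simp
  qed
qed auto

lemma finite_odd_triples: "finite (odd_triples n)"
proof (rule finite_subset)
  show "odd_triples n \<subseteq> {..n} \<times> {..n} \<times> {..n}"
  proof
    fix x assume "x \<in> odd_triples n"
    then obtain r s t where x: "x \<in> odd_triples n" "x = (r, s, t)" by (metis prod_cases3)
    then have a: "(r, s, t) \<in> odd_triples n" by simp
    then obtain s' t' where st: "s = Suc s'" "t = Suc t'"
      by (auto simp: odd_triples_def gr0_conv_Suc)
    with a have "r > 0" "(2 * s' + 1) * (2 * t' + 1) + r * (2 * s' + 2 * t' + 2) = n"
      by (auto simp: odd_triples_def algebra_simps power2_eq_square)
    moreover from \<open>r > 0\<close> have "2 * s' + 2 * t' + 2 \<le> r * (2 * s' + 2 * t' + 2)"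
      by (cases r) simp_all
    moreover have "r * 1 \<le> r * (2 * s' + 2 * t' + 2)"
      by (rule mult_le_mono) simp_all
    ultimately have "r \<le> n" "s \<le> n" "t \<le> n" using st by linarith+
    then show "x \<in> {..n} \<times> {..n} \<times> {..n}" using x by simp
  qed
qed auto

end

theory Submission
  imports Defs
begin

text \<open>Write a form of discriminant \<open>-N\<close> as
  \<open>2 f(u, v) = x u\<^sup>2 + y v\<^sup>2 + z (u - v)\<^sup>2\<close> with \<open>xy + yz + zx = N\<close>. By Selling reduction
  each class contains such a form with \<open>x, y > 0\<close> and \<open>z \<ge> 0\<close>, and it is unique up to rotating
  \<open>(x, y, z)\<close> if \<open>z > 0\<close> and up to exchanging \<open>x\<close> and \<open>y\<close> if \<open>z = 0\<close>. The weights of the classes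
  account for the symmetric triples, so \<open>3 H(N)\<close> is the number of triples with \<open>z > 0\<close> plus
  \<open>3/2\<close> times the number of those with \<open>z = 0\<close>, which are factorizations.

  The triples \<open>(r, s, t)\<close> of the theorem are the positive solutions of \<open>xy + yz + zx = n\<close> with \<open>x\<close>
  and \<open>y\<close> both even or both odd. For \<open>n \<equiv> 1, 2 (mod 4)\<close> exactly one of the three pairs has equal
  parity, so they are a third of all solutions. For \<open>n \<equiv> 3 (mod 4)\<close> restricting a form to a
  sublattice of index 2 gives the map \<open>(x, y, z) \<mapsto> (x, 2y + x, (z - x)/2)\<close>, which compares the
  solutions in odd numbers with those where \<open>x\<close>, \<open>y\<close> are odd and \<open>z\<close> is even.\<close>

section \<open>Obtuse forms\<close>

text \<open>In the notation above \<open>x = 2a + b\<close>, \<open>y = 2c + b\<close> and \<open>z = -b\<close>.\<close>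

definition obtuse_forms :: "nat \<Rightarrow> qform set" where
  "obtuse_forms N = {(a, b, c). b \<le> 0 \<and> 2 * a + b > 0 \<and> 2 * c + b > 0 \<and> 4 * a * c - b^2 = int N}"

text \<open>Since \<open>x, y \<ge> 1\<close>, the equation \<open>xy + zx + zy = N\<close> bounds
  \<open>x + z = 2a\<close> and \<open>y + z = 2c\<close>.\<close>

lemma finite_obtuse_forms: "finite (obtuse_forms N)"
proof (rule finite_subset)
  show "obtuse_forms N \<subseteq> {0..int N} \<times> {- int N..0} \<times> {0..int N}"
  proof
    fix f assume "f \<in> obtuse_forms N"
    then obtain a b c where f: "f = (a, b, c)" "b \<le> 0" "2 * a + b > 0" "2 * c + b > 0"
      "4 * a * c - b^2 = int N"
      by (auto simp: obtuse_forms_def)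
    define x y z where "x = 2 * a + b" and "y = 2 * c + b" and "z = - b"
    have "x > 0" "y > 0" "z \<ge> 0" and e: "x * y + z * x + z * y = int N"
      using f by (auto simp: x_def y_def z_def algebra_simps power2_eq_square)
    then have "x \<le> x * y" "y \<le> x * y" "z \<le> z * x" "z \<le> z * y"
      using mult_left_mono[of 1 y x] mult_right_mono[of 1 x y] mult_left_mono[of 1 x z]
        mult_left_mono[of 1 y z] by linarith+
    then have "x + z \<le> int N" "y + z \<le> int N"
      using e \<open>z \<ge> 0\<close> by linarith+
    then show "f \<in> {0..int N} \<times> {- int N..0} \<times> {0..int N}"
      using f by (auto simp: x_def y_def z_def)
  qed
qed auto

section \<open>Positive definiteness and equivalence in terms of coefficients\<close>

lemma pos_def_iff:
  "pos_def (a, b, c) \<longleftrightarrow> a > 0 \<and> c > 0 \<and> b^2 < 4 * a * c"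
proof
  assume P: "pos_def (a, b, c)"
  have 1: "qeval (a, b, c) x y > 0" if "(x, y) \<noteq> (0, 0)" for x y :: real
    using P that unfolding pos_def_def by blast
  have a: "a > 0" using 1[of 1 0] by simp
  have c: "c > 0" using 1[of 0 1] by simp
  \<comment> \<open>The point \<open>(b, -2a)\<close> is where the square
    \<open>(2ax + by)^2\<close> vanishes, so the form takes the value \<open>a (4ac - b^2)\<close>
    there.\<close>
  have "qeval (a, b, c) (real_of_int b) (real_of_int (- 2 * a)) > 0"
    using a by (intro 1) auto
  then have "real_of_int (a * (4 * a * c - b^2)) > 0"
    by (simp add: algebra_simps power2_eq_square)
  then have "a * (4 * a * c - b^2) > 0" by linarith
  then show "a > 0 \<and> c > 0 \<and> b^2 < 4 * a * c"
    using a c by (simp add: zero_less_mult_iff)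
next
  assume A: "a > 0 \<and> c > 0 \<and> b^2 < 4 * a * c"
  show "pos_def (a, b, c)"
    unfolding pos_def_def
  proof (intro allI impI)
    fix x y :: real assume xy: "(x, y) \<noteq> (0, 0)"
    have e: "4 * a * qeval (a, b, c) x y = (2 * a * x + b * y)^2 + real_of_int (4 * a * c - b^2) * y^2"
      by (simp add: algebra_simps power2_eq_square)
    have d: "real_of_int (4 * a * c - b^2) > 0" using A by linarith
    have "4 * a * qeval (a, b, c) x y > 0"
    proof (cases "y = 0")
      case True
      then show ?thesis using xy A by simp
    next
      case False
      then show ?thesis unfolding e using d by (intro add_nonneg_pos mult_pos_pos) auto
    qed
    then show "qeval (a, b, c) x y > 0"
      using A by (simp add: zero_less_mult_iff)
  qed
qed

lemma obtuse_forms_subset: "N > 0 \<Longrightarrow> obtuse_forms N \<subseteq> pd_forms N"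
  by (auto simp: obtuse_forms_def pd_forms_def pos_def_iff)

text \<open>A form is determined by its values at \<open>(1,0)\<close>, \<open>(0,1)\<close> and
  \<open>(1,1)\<close>, so equivalence becomes three polynomial identities in the matrix
  entries.\<close>

lemma sl2_equiv_coeffs:
  "sl2_equiv (a, b, c) (a', b', c') \<longleftrightarrow> (\<exists>p q u v. p * v - q * u = 1 \<and>
     a' = a * p^2 + b * p * u + c * u^2 \<and>
     b' = 2 * a * p * q + b * (p * v + q * u) + 2 * c * u * v \<and>
     c' = a * q^2 + b * q * v + c * v^2)"
proof -
  have "(\<forall>x y :: int. qeval (a', b', c') x y = qeval (a, b, c) (p * x + q * y) (u * x + v * y)) \<longleftrightarrow>
     a' = a * p^2 + b * p * u + c * u^2 \<and>
     b' = 2 * a * p * q + b * (p * v + q * u) + 2 * c * u * v \<and>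
     c' = a * q^2 + b * q * v + c * v^2" (is "?L \<longleftrightarrow> ?R") for p q u v
  proof
    assume L: ?L
    show ?R using L[rule_format, of 1 0] L[rule_format, of 0 1] L[rule_format, of 1 1]
      by (auto simp: algebra_simps power2_eq_square)
  next
    assume ?R
    then show ?L by (simp add: algebra_simps power2_eq_square)
  qed
  then show ?thesis unfolding sl2_equiv_def by simp
qed

lemma sl2_equiv_sym: "sl2_equiv f g \<Longrightarrow> sl2_equiv g f"
proof -
  assume "sl2_equiv f g"
  obtain a b c a' b' c' where [simp]: "f = (a, b, c)" "g = (a', b', c')" by (cases f, cases g) auto
  obtain p q u v where d: "p * v - q * u = 1" and
     "a' = a * p^2 + b * p * u + c * u^2"
     "b' = 2 * a * p * q + b * (p * v + q * u) + 2 * c * u * v"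
     "c' = a * q^2 + b * q * v + c * v^2"
    using \<open>sl2_equiv f g\<close> by (auto simp: sl2_equiv_coeffs)
  \<comment> \<open>Substituting by the adjugate matrix returns the original form times the squared
    determinant, which is 1.\<close>
  then have "a * (p * v - q * u)^2 = a' * v^2 + b' * v * (-u) + c' * (-u)^2"
     "b * (p * v - q * u)^2 = 2 * a' * v * (-q) + b' * (v * p + (-q) * (-u)) + 2 * c' * (-u) * p"
     "c * (p * v - q * u)^2 = a' * (-q)^2 + b' * (-q) * p + c' * p^2"
    by algebra+
  moreover have "v * p - (-q) * (-u) = 1" using d by (simp add: algebra_simps)
  ultimately show ?thesis unfolding d \<open>f = _\<close> \<open>g = _\<close> sl2_equiv_coeffs
    by (simp only: one_power2 mult_1_right) blast
qed

lemma sl2_equiv_trans: "sl2_equiv f g \<Longrightarrow> sl2_equiv g h \<Longrightarrow> sl2_equiv f h"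
proof -
  assume "sl2_equiv f g" "sl2_equiv g h"
  obtain a b c a' b' c' a'' b'' c''
    where [simp]: "f = (a, b, c)" "g = (a', b', c')" "h = (a'', b'', c'')"
    by (cases f, cases g, cases h) auto
  obtain p q u v where d: "p * v - q * u = 1" and 1:
     "a' = a * p^2 + b * p * u + c * u^2"
     "b' = 2 * a * p * q + b * (p * v + q * u) + 2 * c * u * v"
     "c' = a * q^2 + b * q * v + c * v^2"
    using \<open>sl2_equiv f g\<close> by (auto simp: sl2_equiv_coeffs)
  obtain p' q' u' v' where d': "p' * v' - q' * u' = 1" and 2:
     "a'' = a' * p'^2 + b' * p' * u' + c' * u'^2"
     "b'' = 2 * a' * p' * q' + b' * (p' * v' + q' * u') + 2 * c' * u' * v'"
     "c'' = a' * q'^2 + b' * q' * v' + c' * v'^2"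
    using \<open>sl2_equiv g h\<close> by (auto simp: sl2_equiv_coeffs)
  define P Q U V where "P = p*p' + q*u'" and "Q = p*q' + q*v'" and "U = u*p' + v*u'" and "V = u*q' + v*v'"
  have "P * V - Q * U = (p * v - q * u) * (p' * v' - q' * u')"
    by (simp add: P_def Q_def U_def V_def algebra_simps)
  then have "P * V - Q * U = 1" by (simp add: d d')
  moreover have
     "a'' = a * P^2 + b * P * U + c * U^2"
     "b'' = 2 * a * P * Q + b * (P * V + Q * U) + 2 * c * U * V"
     "c'' = a * Q^2 + b * Q * V + c * V^2"
    unfolding 1 2 P_def Q_def U_def V_def by algebra+
  ultimately show ?thesis by (auto simp: sl2_equiv_coeffs)
qed

text \<open>The discriminant is multiplied by the squared determinant. The outer coefficients of
  \<open>g\<close> are values of \<open>f\<close>, hence nonnegative, and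
  \<open>4a'c' = b'^2 + N > 0\<close> makes them positive.\<close>

lemma pd_forms_sl2_equiv:
  assumes "sl2_equiv f g" "f \<in> pd_forms N" "N > 0"
  shows "g \<in> pd_forms N"
proof -
  obtain a b c a' b' c' where fg: "f = (a, b, c)" "g = (a', b', c')" by (cases f, cases g) auto
  obtain p q u v where d: "p * v - q * u = 1" and e:
     "a' = a * p^2 + b * p * u + c * u^2"
     "b' = 2 * a * p * q + b * (p * v + q * u) + 2 * c * u * v"
     "c' = a * q^2 + b * q * v + c * v^2"
    using assms(1) by (auto simp: fg sl2_equiv_coeffs)
  have D: "a > 0" "b^2 - 4 * a * c = - int N" using assms(2) by (auto simp: fg pd_forms_def pos_def_iff)
  have "b'^2 - 4 * a' * c' = (b^2 - 4 * a * c) * (p * v - q * u)^2"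
    unfolding e by algebra
  then have D': "b'^2 - 4 * a' * c' = - int N" using D d by simp
  have nonneg: "a * x^2 + b * x * y + c * y^2 \<ge> 0" for x y
  proof -
    have "4 * a * (a * x^2 + b * x * y + c * y^2) = (2*a*x + b*y)^2 - (b^2 - 4 * a * c) * y^2"
      by algebra
    then have "4 * a * (a * x^2 + b * x * y + c * y^2) \<ge> 0" using D by simp
    then show ?thesis using \<open>a > 0\<close> by (simp add: zero_le_mult_iff)
  qed
  have "a' \<ge> 0" "c' \<ge> 0" unfolding e by (rule nonneg)+
  moreover have "4 * (a' * c') > 0"
    using D' assms(3) zero_le_power2[of b'] by linarith
  ultimately have "a' > 0" "c' > 0" by (auto simp: zero_less_mult_iff)
  then show ?thesis using D' assms(3) by (auto simp: fg pd_forms_def pos_def_iff)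
qed

text \<open>Selling reduction: a minimum of \<open>f(1,0) + f(0,1) + f(1,1)\<close> over the class is obtuse.\<close>

lemma obtuse_representative:
  assumes "f \<in> pd_forms N" "N > 0"
  shows "\<exists>g \<in> obtuse_forms N. sl2_equiv f g"
proof -
  \<comment> \<open>The descent stops at the weak inequalities; the boundary cases
    \<open>2a + b = 0\<close> and \<open>2c + b = 0\<close> are repaired afterwards.\<close>
  have ex: "\<exists>a b c. sl2_equiv f (a, b, c) \<and> (a, b, c) \<in> pd_forms N \<and>
      b \<le> 0 \<and> 2 * a + b \<ge> 0 \<and> 2 * c + b \<ge> 0"
    if "f \<in> pd_forms N" for f
    using that
  proof (induction "nat (case f of (a, b, c) \<Rightarrow> 2 * a + b + 2 * c)" arbitrary: f rule: less_induct)
    case less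
    obtain a b c where f: "f = (a, b, c)" by (cases f)
    have p: "a > 0" "c > 0" "4 * a * c - b^2 > 0"
      using less.prems assms(2) by (auto simp: f pd_forms_def pos_def_iff)
    \<comment> \<open>This is \<open>f(1,1)\<close>. Its positivity makes the measure positive, so
      that \<open>nat\<close> does not hide a decrease.\<close>
    have "a + b + c > 0"
    proof -
      have "4 * a * (a + b + c) = (2 * a + b)^2 + (4 * a * c - b^2)"
        by algebra
      then have "4 * a * (a + b + c) > 0" using p(3) zero_le_power2[of "2 * a + b"] by linarith
      then show ?thesis using p(1) by (simp add: zero_less_mult_iff)
    qed
    then have pos: "2 * a + b + 2 * c > 0" using p by linarith
    have step: ?case if "sl2_equiv f (a', b', c')" "2 * a' + b' + 2 * c' < 2 * a + b + 2 * c"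
      for a' b' c'
    proof -
      have "(a', b', c') \<in> pd_forms N" using pd_forms_sl2_equiv that less.prems assms(2) by blast
      with less.hyps[of "(a', b', c')"] that(2) pos sl2_equiv_trans[OF that(1)]
      show ?thesis by (simp add: f) (metis (no_types, lifting))
    qed
    \<comment> \<open>Each violated inequality admits a substitution that lowers the measure, by
      \<open>2b\<close>, \<open>-2(2a + b)\<close> and \<open>-2(2c + b)\<close>
      respectively.\<close>
    consider "b > 0" | "2 * a + b < 0" | "2 * c + b < 0" | "b \<le> 0 \<and> 2 * a + b \<ge> 0 \<and> 2 * c + b \<ge> 0"
      by linarith
    then show ?case
    proof cases
      case 1
      have "sl2_equiv f (c, -b, a)"
        unfolding f sl2_equiv_coeffs by (rule exI[of _ 0], rule exI[of _ 1], rule exI[of _ "-1"], rule exI[of _ 0]) simp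
      then show ?thesis using 1 by (intro step[of c "-b" a]) auto
    next
      case 2
      have "sl2_equiv f (a, 2 * a + b, a + b + c)"
        unfolding f sl2_equiv_coeffs by (rule exI[of _ 1], rule exI[of _ 1], rule exI[of _ 0], rule exI[of _ 1]) simp
      then show ?thesis using 2 by (rule_tac step) auto
    next
      case 3
      have "sl2_equiv f (a + b + c, 2 * c + b, c)"
        unfolding f sl2_equiv_coeffs by (rule exI[of _ 1], rule exI[of _ 0], rule exI[of _ 1], rule exI[of _ 1]) simp
      then show ?thesis using 3 by (rule_tac step) auto
    next
      case 4
      have "sl2_equiv f f"
        unfolding f sl2_equiv_coeffs by (rule exI[of _ 1], rule exI[of _ 0], rule exI[of _ 0], rule exI[of _ 1]) simp
      then show ?thesis using 4 less.prems f by blast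
    qed
  qed
  obtain a b c where g: "sl2_equiv f (a, b, c)" "(a, b, c) \<in> pd_forms N"
      "b \<le> 0" "2 * a + b \<ge> 0" "2 * c + b \<ge> 0"
    using ex[OF assms(1)] by blast
  have p: "a > 0" "c > 0" "4 * a * c - b^2 = int N" "int N > 0"
    using g(2) assms(2) by (auto simp: pd_forms_def pos_def_iff)
  consider "2 * a + b > 0" "2 * c + b > 0" | "2 * a + b = 0" | "2 * c + b = 0"
    using g by linarith
  then show ?thesis
  proof cases
    case 1
    then show ?thesis using g p by (auto simp: obtuse_forms_def)
  next
    case 2
    \<comment> \<open>In the coordinates \<open>(x, y, z)\<close> this is the rotation to
      \<open>(y, z, x)\<close>: the zero moves from \<open>x\<close> to the last place, where it is
      allowed.\<close>
    have "sl2_equiv (a, b, c) (a + b + c, - (2 * a + b), a)"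
      unfolding sl2_equiv_coeffs by (rule exI[of _ "-1"], rule exI[of _ 1], rule exI[of _ "-1"], rule exI[of _ 0]) simp
    moreover have "(a + b + c, - (2 * a + b), a) \<in> obtuse_forms N"
    proof -
      have b: "b = - 2 * a" using 2 by simp
      have "4 * a * (c - a) > 0" using p unfolding b by (simp add: algebra_simps power2_eq_square)
      then have "c > a" using p by (simp add: zero_less_mult_iff)
      then show ?thesis using p by (auto simp: obtuse_forms_def b algebra_simps power2_eq_square)
    qed
    ultimately show ?thesis using sl2_equiv_trans[OF g(1)] by blast
  next
    case 3
    \<comment> \<open>The opposite rotation, to \<open>(z, x, y)\<close>, moves the zero from
      \<open>y\<close> to the last place.\<close>
    have "sl2_equiv (a, b, c) (c, - (2 * c + b), a + b + c)"
      unfolding sl2_equiv_coeffs by (rule exI[of _ 0], rule exI[of _ "-1"], rule exI[of _ "1"], rule exI[of _ "-1"]) simp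
    moreover have "(c, - (2 * c + b), a + b + c) \<in> obtuse_forms N"
    proof -
      have b: "b = - 2 * c" using 3 by simp
      have "4 * c * (a - c) > 0" using p unfolding b by (simp add: algebra_simps power2_eq_square)
      then have "a > c" using p by (simp add: zero_less_mult_iff)
      then show ?thesis using p by (auto simp: obtuse_forms_def b algebra_simps power2_eq_square)
    qed
    ultimately show ?thesis using sl2_equiv_trans[OF g(1)] by blast
  qed
qed

section \<open>Uniqueness of obtuse representatives\<close>

text \<open>Twice the form is \<open>p^2 + q^2 + (p + q)^2\<close>.\<close>

lemma loeschian_ge_1:
  fixes p q :: int
  assumes "(p, q) \<noteq> (0, 0)"
  shows "p^2 + p * q + q^2 \<ge> 1"
proof -
  have e: "2 * (p^2 + p * q + q^2) = p^2 + q^2 + (p + q)^2" by algebra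
  have "p^2 + q^2 > 0" using assms by (auto simp: sum_power2_gt_zero_iff)
  then have "2 * (p^2 + p * q + q^2) > 0" using e zero_le_power2[of "p + q"] by linarith
  then show ?thesis by simp
qed

text \<open>Four times the form is \<open>3p^2 + (2q + p)^2\<close>, and symmetrically in
  \<open>q\<close>; the value 4 leaves no room for an entry of absolute value 2.\<close>

lemma loeschian_eq_1:
  fixes p q :: int
  assumes "p^2 + p * q + q^2 = 1"
  shows "p \<in> {-1, 0, 1} \<and> q \<in> {-1, 0, 1}"
proof -
  have *: "x \<in> {-1, 0, 1}" if "3 * x^2 \<le> 4" for x :: int
  proof -
    have "x^2 < 2^2" using that by simp
    then have "\<bar>x\<bar> < 2" using power2_less_imp_less[of "\<bar>x\<bar>" 2] by simp
    then show ?thesis by auto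
  qed
  have "3 * p^2 + (2 * q + p)^2 = 4" "3 * q^2 + (2 * p + q)^2 = 4" using assms by algebra+
  then have "3 * p^2 \<le> 4" "3 * q^2 \<le> 4"
    using zero_le_power2[of "2 * q + p"] zero_le_power2[of "2 * p + q"] by linarith+
  with * show ?thesis by blast
qed

text \<open>\<open>2a + b + 2c = f(1,0) + f(0,1) + f(1,1)\<close> is minimal over the class at every obtuse form;
  comparing two obtuse forms leaves only transformations with entries in \<open>{-1, 0, 1}\<close>.\<close>

lemma obtuse_sum_identity:
  fixes a b c :: int
  assumes "a' = a * p^2 + b * p * u + c * u^2"
     "b' = 2 * a * p * q + b * (p * v + q * u) + 2 * c * u * v"
     "c' = a * q^2 + b * q * v + c * v^2"
   shows "2 * a' + b' + 2 * c' = (2 * a + b) * (p^2 + p * q + q^2) + (2 * c + b) * (u^2 + u * v + v^2)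
     + (- b) * ((p - u)^2 + (p - u) * (q - v) + (q - v)^2)"
  unfolding assms by algebra

text \<open>The identity writes the sum for \<open>g\<close> as a combination with the nonnegative
  weights \<open>x\<close>, \<open>y\<close>, \<open>z\<close> of the norm form at
  \<open>(p, q)\<close>, \<open>(u, v)\<close> and \<open>(p - u, q - v)\<close>. None of these
  vectors vanishes, because the determinant is 1, so the total is at least \<open>x + y + z\<close>,
  the sum for \<open>f\<close>.\<close>

lemma obtuse_sum_le:
  assumes "f \<in> obtuse_forms N" "sl2_equiv f g"
  shows "(case f of (a, b, c) \<Rightarrow> 2 * a + b + 2 * c) \<le> (case g of (a, b, c) \<Rightarrow> 2 * a + b + 2 * c)"
proof -
  obtain a b c a' b' c' where fg: "f = (a, b, c)" "g = (a', b', c')" by (cases f, cases g) auto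
  obtain p q u v where d: "p * v - q * u = 1" and e:
     "a' = a * p^2 + b * p * u + c * u^2"
     "b' = 2 * a * p * q + b * (p * v + q * u) + 2 * c * u * v"
     "c' = a * q^2 + b * q * v + c * v^2"
    using assms(2) by (auto simp: fg sl2_equiv_coeffs)
  have "(p, q) \<noteq> (0, 0)" "(u, v) \<noteq> (0, 0)" "(p - u, q - v) \<noteq> (0, 0)" using d by auto
  then have "1 \<le> p^2 + p * q + q^2" "1 \<le> u^2 + u * v + v^2"
    "1 \<le> (p - u)^2 + (p - u) * (q - v) + (q - v)^2"
    by (blast intro: loeschian_ge_1)+
  then have "(2 * a + b) * 1 \<le> (2 * a + b) * (p^2 + p * q + q^2)"
    "(2 * c + b) * 1 \<le> (2 * c + b) * (u^2 + u * v + v^2)"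
    "(- b) * 1 \<le> (- b) * ((p - u)^2 + (p - u) * (q - v) + (q - v)^2)"
    using assms(1) by (auto simp: fg obtuse_forms_def intro!: mult_left_mono simp del: mult_minus_left mult_1_right)
  then show ?thesis using obtuse_sum_identity[OF e] by (simp add: fg)
qed

text \<open>Minimality in both directions makes the two sums equal, so every term of the combination
  attains its minimum. The strictly positive weights \<open>x\<close> and \<open>y\<close> then
  force norm 1 for both rows of the matrix, and a finite check remains.\<close>

lemma obtuse_equiv_imp:
  assumes "(a, b, c) \<in> obtuse_forms N" "(a', b', c') \<in> obtuse_forms N" "sl2_equiv (a, b, c) (a', b', c')"
  shows "(a', b', c') \<in> {(a, b, c), (c, - (2 * c + b), a + b + c), (a + b + c, - (2 * a + b), a)}
    \<or> b = 0 \<and> (a', b', c') = (c, 0, a)"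
proof -
  obtain p q u v where d: "p * v - q * u = 1" and e:
     "a' = a * p^2 + b * p * u + c * u^2"
     "b' = 2 * a * p * q + b * (p * v + q * u) + 2 * c * u * v"
     "c' = a * q^2 + b * q * v + c * v^2"
    using assms(3) by (auto simp: sl2_equiv_coeffs)
  have eq: "2 * a' + b' + 2 * c' = 2 * a + b + 2 * c"
    using obtuse_sum_le[OF assms(1,3)] obtuse_sum_le[OF assms(2) sl2_equiv_sym[OF assms(3)]] by simp
  have o: "b \<le> 0" "2 * a + b > 0" "2 * c + b > 0" "b' \<le> 0" "2 * a' + b' > 0" "2 * c' + b' > 0"
    using assms by (auto simp: obtuse_forms_def)
  define A B C where "A = p^2 + p * q + q^2" and "B = u^2 + u * v + v^2"
    and "C = (p - u)^2 + (p - u) * (q - v) + (q - v)^2"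
  have "(p, q) \<noteq> (0, 0)" "(u, v) \<noteq> (0, 0)" "(p - u, q - v) \<noteq> (0, 0)" using d by auto
  then have ge: "A \<ge> 1" "B \<ge> 1" "C \<ge> 1"
    unfolding A_def B_def C_def by (blast intro: loeschian_ge_1)+
  \<comment> \<open>Each summand is a weight times the excess of a norm over 1, hence
    nonnegative.\<close>
  have id: "(2 * a + b) * (A - 1) + (2 * c + b) * (B - 1) + (- b) * (C - 1) = 0"
    using obtuse_sum_identity[OF e, folded A_def B_def C_def] eq by (simp add: algebra_simps)
  have "(2 * a + b) * (A - 1) \<ge> 0" "(2 * c + b) * (B - 1) \<ge> 0" "(- b) * (C - 1) \<ge> 0"
    using o ge by (auto intro!: mult_nonneg_nonneg simp del: mult_minus_left)
  then have "(2 * a + b) * (A - 1) = 0" "(2 * c + b) * (B - 1) = 0"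
    using id by linarith+
  then have "A = 1" "B = 1" using o by auto
  then have "p \<in> {-1, 0, 1}" "q \<in> {-1, 0, 1}" "u \<in> {-1, 0, 1}" "v \<in> {-1, 0, 1}"
    using loeschian_eq_1 unfolding A_def B_def by blast+
  then show ?thesis using d e o by (elim insertE emptyE; simp)
qed

text \<open>If \<open>z > 0\<close>, all rotations of \<open>(x, y, z)\<close> stay obtuse. If
  \<open>z = 0\<close>, a proper rotation would put the zero in a place required to be positive, and
  the exchange of \<open>x\<close> and \<open>y\<close> takes over. The listed forms may
  coincide.\<close>

lemma obtuse_class:
  assumes "(a, b, c) \<in> obtuse_forms N"
  shows "{g \<in> obtuse_forms N. sl2_equiv (a, b, c) g} =
    (if b = 0 then {(a, b, c), (c, b, a)}
     else {(a, b, c), (c, - (2 * c + b), a + b + c), (a + b + c, - (2 * a + b), a)})"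
proof -
  have 1: "sl2_equiv (a, b, c) (a, b, c)"
    unfolding sl2_equiv_coeffs by (rule exI[of _ 1], rule exI[of _ 0], rule exI[of _ 0], rule exI[of _ 1]) simp
  have 2: "sl2_equiv (a, b, c) (c, - (2 * c + b), a + b + c)"
    unfolding sl2_equiv_coeffs by (rule exI[of _ 0], rule exI[of _ "-1"], rule exI[of _ "1"], rule exI[of _ "-1"]) simp
  have 3: "sl2_equiv (a, b, c) (a + b + c, - (2 * a + b), a)"
    unfolding sl2_equiv_coeffs by (rule exI[of _ "-1"], rule exI[of _ 1], rule exI[of _ "-1"], rule exI[of _ 0]) simp
  have 4: "sl2_equiv (a, b, c) (c, - b, a)"
    unfolding sl2_equiv_coeffs by (rule exI[of _ 0], rule exI[of _ 1], rule exI[of _ "-1"], rule exI[of _ 0]) simp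
  have o: "b \<le> 0" "2 * a + b > 0" "2 * c + b > 0" "4 * a * c - b^2 = int N"
    using assms by (auto simp: obtuse_forms_def)
  show ?thesis
  proof (cases "b = 0")
    case True
    have "g \<in> {(a, b, c), (c, b, a)}" if "g \<in> obtuse_forms N" "sl2_equiv (a, b, c) g" for g
    proof -
      obtain a' b' c' where g: "g = (a', b', c')" by (cases g)
      then show ?thesis using obtuse_equiv_imp[OF assms that[unfolded g]] that True o
        by (auto simp: obtuse_forms_def)
    qed
    moreover have "(c, b, a) \<in> obtuse_forms N" using True o by (auto simp: obtuse_forms_def mult.commute mult.left_commute)
    ultimately show ?thesis using 1 4 True assms by auto
  next
    case False
    have "(c, - (2 * c + b), a + b + c) \<in> obtuse_forms N" "(a + b + c, - (2 * a + b), a) \<in> obtuse_forms N"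
      using o False by (auto simp: obtuse_forms_def algebra_simps power2_eq_square)
    moreover have "g \<in> {(a, b, c), (c, - (2 * c + b), a + b + c), (a + b + c, - (2 * a + b), a)}"
      if "g \<in> obtuse_forms N" "sl2_equiv (a, b, c) g" for g
    proof -
      obtain a' b' c' where g: "g = (a', b', c')" by (cases g)
      then show ?thesis using obtuse_equiv_imp[OF assms that[unfolded g]] False by auto
    qed
    ultimately show ?thesis using 1 2 3 False assms by auto
  qed
qed

section \<open>The class number as a weighted count of obtuse forms\<close>

text \<open>A generic class has three obtuse forms of weight 1, or two of weight \<open>3/2\<close>
  if \<open>b = 0\<close>. In the square class the two coincide, in the hexagonal class the three
  do, which matches the weights \<open>1/2\<close> and \<open>1/3\<close>.\<close>

lemma sum_obtuse_class:
  assumes "(a, b, c) \<in> obtuse_forms N" "N > 0"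
    and C: "C = {g \<in> pd_forms N. sl2_equiv (a, b, c) g}"
  shows "(\<Sum>(a', b', c')\<in>{g \<in> obtuse_forms N. sl2_equiv (a, b, c) g}. if b' = 0 then 3/2 else 1)
    = 3 * class_weight C"
proof -
  have o: "b \<le> 0" "2 * a + b > 0" "2 * c + b > 0" "4 * a * c - b^2 = int N"
    using assms by (auto simp: obtuse_forms_def)
  have sub: "obtuse_forms N \<subseteq> pd_forms N" using obtuse_forms_subset assms by blast
  note cls = obtuse_class[OF assms(1)]
  have square: "(\<exists>d. (d, 0, d) \<in> C) \<longleftrightarrow> b = 0 \<and> a = c"
  proof
    assume "\<exists>d. (d, 0, d) \<in> C"
    then obtain d where d: "(d, 0, d) \<in> pd_forms N" "sl2_equiv (a, b, c) (d, 0, d)" by (auto simp: C)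
    then have "(d, 0, d) \<in> obtuse_forms N"
      by (auto simp: obtuse_forms_def pd_forms_def pos_def_iff)
    with d cls have "(d, 0, d) \<in> (if b = 0 then {(a, b, c), (c, b, a)}
     else {(a, b, c), (c, - (2 * c + b), a + b + c), (a + b + c, - (2 * a + b), a)})" by blast
    then show "b = 0 \<and> a = c" using o by (auto split: if_splits)
  next
    assume "b = 0 \<and> a = c"
    then have "(a, 0, a) \<in> C" using cls assms sub by (auto simp: C)
    then show "\<exists>d. (d, 0, d) \<in> C" ..
  qed
  \<comment> \<open>\<open>class_weight\<close> recognises the hexagonal class by
    \<open>(d, d, d)\<close>, whose obtuse partner is \<open>(d, -d, d)\<close>.\<close>
  have rot: "sl2_equiv (d, e, d) (d, - e, d)" for d e
    unfolding sl2_equiv_coeffs by (rule exI[of _ 0], rule exI[of _ 1], rule exI[of _ "-1"], rule exI[of _ 0]) simp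
  have hex: "(\<exists>d. (d, d, d) \<in> C) \<longleftrightarrow> b = - a \<and> c = a"
  proof
    assume "\<exists>d. (d, d, d) \<in> C"
    then obtain d where d: "(d, d, d) \<in> pd_forms N" "sl2_equiv (a, b, c) (d, d, d)" by (auto simp: C)
    then have "sl2_equiv (a, b, c) (d, - d, d)" using rot sl2_equiv_trans by blast
    moreover have "(d, - d, d) \<in> obtuse_forms N"
      using d by (auto simp: obtuse_forms_def pd_forms_def pos_def_iff)
    ultimately have "(d, - d, d) \<in> (if b = 0 then {(a, b, c), (c, b, a)}
     else {(a, b, c), (c, - (2 * c + b), a + b + c), (a + b + c, - (2 * a + b), a)})" using cls by blast
    then show "b = - a \<and> c = a" using o by (auto split: if_splits)
  next
    assume A: "b = - a \<and> c = a"
    then have "sl2_equiv (a, b, c) (a, a, a)" using rot[of a "-a"] by simp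
    moreover from this have "(a, a, a) \<in> pd_forms N" using pd_forms_sl2_equiv assms sub by blast
    ultimately show "\<exists>d. (d, d, d) \<in> C" by (auto simp: C)
  qed
  have "a > 0" using o by linarith
  consider "b = 0" "a = c" | "b = 0" "a \<noteq> c" | "b \<noteq> 0" "b = - a" "c = a"
    | "b \<noteq> 0" "\<not> (b = - a \<and> c = a)" by blast
  then show ?thesis
  proof cases
    case 4
    \<comment> \<open>A proper rotation fixes \<open>(x, y, z)\<close> only if
      \<open>x = y = z\<close>, which is the hexagonal case.\<close>
    then have "(a, b, c) \<noteq> (c, - (2 * c + b), a + b + c)" "(a, b, c) \<noteq> (a + b + c, - (2 * a + b), a)"
      "(c, - (2 * c + b), a + b + c) \<noteq> (a + b + c, - (2 * a + b), a)"
      by auto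
    then show ?thesis unfolding cls class_weight_def square hex using 4 o by simp
  qed (unfold cls class_weight_def square hex, use \<open>a > 0\<close> in simp_all)
qed

text \<open>Every class contains an obtuse form, so grouping the obtuse forms by class runs over all
  of \<open>form_classes N\<close>, each class contributing three times its weight.\<close>

lemma hurwitz_H_obtuse:
  assumes "N > 0" "N mod 4 = 0 \<or> N mod 4 = 3"
  shows "(\<Sum>(a, b, c)\<in>obtuse_forms N. if b = 0 then 3/2 else 1) = 3 * hurwitz_H N"
proof -
  define R where "R = {(f, g). f \<in> pd_forms N \<and> g \<in> pd_forms N \<and> sl2_equiv f g}"
  have R: "equiv (pd_forms N) R" unfolding R_def by (rule equiv_sl2)
  have sub: "obtuse_forms N \<subseteq> pd_forms N" using obtuse_forms_subset assms by blast
  have cl: "R `` {f} = {g \<in> pd_forms N. sl2_equiv f g}" if "f \<in> pd_forms N" for f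
    using that by (auto simp: R_def)
  have img: "form_classes N = (\<lambda>f. R `` {f}) ` obtuse_forms N"
  proof
    show "form_classes N \<subseteq> (\<lambda>f. R `` {f}) ` obtuse_forms N"
    proof
      fix C assume "C \<in> form_classes N"
      then obtain f where f: "f \<in> pd_forms N" "C = R `` {f}"
        by (auto simp: form_classes_def R_def quotient_def)
      obtain g where g: "g \<in> obtuse_forms N" "sl2_equiv f g"
        using obtuse_representative f assms by blast
      then have "(f, g) \<in> R" using f sub by (auto simp: R_def)
      then have "C = R `` {g}" using equiv_class_eq[OF R] f by blast
      then show "C \<in> (\<lambda>f. R `` {f}) ` obtuse_forms N" using g by blast
    qed
    show "(\<lambda>f. R `` {f}) ` obtuse_forms N \<subseteq> form_classes N"
      using sub unfolding form_classes_def R_def[symmetric] by (auto intro: quotientI)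
  qed
  let ?w = "\<lambda>(a :: int, b :: int, c :: int). if b = 0 then 3/2 else 1 :: real"
  have "sum ?w (obtuse_forms N) =
      (\<Sum>C\<in>form_classes N. sum ?w {g \<in> obtuse_forms N. R `` {g} = C})"
    by (rule sum.group[symmetric]) (auto simp: img finite_obtuse_forms)
  also have "\<dots> = (\<Sum>C\<in>form_classes N. 3 * class_weight C)"
  proof (rule sum.cong[OF refl])
    fix C assume "C \<in> form_classes N"
    then obtain f where f: "f \<in> obtuse_forms N" "C = R `` {f}" by (auto simp: img)
    have "{g \<in> obtuse_forms N. R `` {g} = C} = {g \<in> obtuse_forms N. sl2_equiv f g}"
    proof (rule Collect_cong, rule conj_cong[OF refl])
      fix g assume "g \<in> obtuse_forms N"
      then have "R `` {f} = R `` {g} \<longleftrightarrow> (f, g) \<in> R"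
        using f sub by (intro eq_equiv_class_iff[OF R]) auto
      then show "R `` {g} = C \<longleftrightarrow> sl2_equiv f g"
        using f sub \<open>g \<in> obtuse_forms N\<close> by (auto simp: R_def)
    qed
    moreover obtain a b c where "f = (a, b, c)" by (cases f)
    ultimately show "sum ?w {g \<in> obtuse_forms N. R `` {g} = C} = 3 * class_weight C"
      using sum_obtuse_class[of a b c N C] f assms cl[of f] sub by auto
  qed
  also have "\<dots> = 3 * hurwitz_H N"
    using assms by (auto simp: hurwitz_H_def sum_distrib_left)
  finally show ?thesis by simp
qed

section \<open>Positive solutions of \<open>xy + yz + zx = n\<close>\<close>

definition pos_triples :: "nat \<Rightarrow> (int \<times> int \<times> int) set" where
  "pos_triples n = {(x, y, z). x > 0 \<and> y > 0 \<and> z > 0 \<and> x * y + y * z + z * x = int n}"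

lemma finite_pos_triples [simp]: "finite (pos_triples n)"
proof (rule finite_subset)
  show "pos_triples n \<subseteq> {0..int n} \<times> {0..int n} \<times> {0..int n}"
  proof
    fix f assume "f \<in> pos_triples n"
    then obtain x y z where f: "f = (x, y, z)" "x > 0" "y > 0" "z > 0"
      "x * y + y * z + z * x = int n"
      by (auto simp: pos_triples_def)
    then have "x \<le> x * y" "y \<le> y * z" "z \<le> z * x"
      using mult_left_mono[of 1 y x] mult_left_mono[of 1 z y] mult_left_mono[of 1 x z]
      by linarith+
    then have "x \<le> int n" "y \<le> int n" "z \<le> int n"
      using f by linarith+
    then show "f \<in> {0..int n} \<times> {0..int n} \<times> {0..int n}"
      using f by auto
  qed
qed auto

lemma finite_pos_triples_sub [simp]: "finite {(x, y, z) \<in> pos_triples n. P x y z}"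
  by (rule finite_subset[OF _ finite_pos_triples[of n]]) auto

text \<open>These are the solutions of \<open>xy + yz + zx = n\<close> on the boundary
  \<open>z = 0\<close>, with integer entries to match \<open>pos_triples\<close>.\<close>

definition factor_pairs :: "nat \<Rightarrow> (int \<times> int) set" where
  "factor_pairs n = {(p, q). p > 0 \<and> q > 0 \<and> p * q = int n}"

lemma bij_betw_factor_pairs:
  assumes "n > 0"
  shows "bij_betw (\<lambda>d. (int d, int (n div d))) {d. d dvd n} (factor_pairs n)"
proof (rule bij_betw_imageI)
  show "inj_on (\<lambda>d. (int d, int (n div d))) {d. d dvd n}" by (auto simp: inj_on_def)
  show "(\<lambda>d. (int d, int (n div d))) ` {d. d dvd n} = factor_pairs n" (is "?f ` ?A = ?B")
  proof
    show "?f ` ?A \<subseteq> ?B"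
      using assms by (auto simp: factor_pairs_def dvd_def zero_less_mult_iff)
    show "?B \<subseteq> ?f ` ?A"
    proof
      fix f assume "f \<in> ?B"
      then obtain p q where f: "f = (p, q)" "p > 0" "q > 0" "p * q = int n"
        by (auto simp: factor_pairs_def)
      then obtain i j where ij: "p = int i" "q = int j" by (metis zero_less_imp_eq_int)
      with f have "n = i * j" by (metis of_nat_eq_iff of_nat_mult)
      then show "f \<in> ?f ` ?A" using f ij by auto
    qed
  qed
qed

lemma card_factor_pairs: "n > 0 \<Longrightarrow> card (factor_pairs n) = sigma0 n"
  using bij_betw_same_card[OF bij_betw_factor_pairs] by (simp add: sigma0_def)

lemma finite_factor_pairs: "n > 0 \<Longrightarrow> finite (factor_pairs n)"
  using bij_betw_finite[OF bij_betw_factor_pairs] by simp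

lemma card_pos_triples_rotate:
  "card {(x, y, z) \<in> pos_triples n. P y z x} = card {(x, y, z) \<in> pos_triples n. P x y z}"
  by (rule bij_betw_same_card[of "\<lambda>(x, y, z). (y, z, x)"],
      rule bij_betw_byWitness[where f' = "\<lambda>(x, y, z). (z, x, y)"])
     (auto simp: pos_triples_def algebra_simps)

text \<open>If exactly one rotation of each triple satisfies \<open>P\<close>, the solutions split
  into three rotated copies of those satisfying \<open>P\<close>.\<close>

lemma card_pos_triples_rotations:
  assumes Q: "\<And>x y z. Q x y z \<longleftrightarrow> Q y z x"
    and ex: "\<And>x y z. (x, y, z) \<in> pos_triples n \<Longrightarrow> Q x y z \<Longrightarrow> P x y z \<or> P y z x \<or> P z x y"
    and un: "\<And>x y z. (x, y, z) \<in> pos_triples n \<Longrightarrow> Q x y z \<Longrightarrow> P x y z \<Longrightarrow> \<not> P y z x \<and> \<not> P z x y"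
  shows "card {(x, y, z) \<in> pos_triples n. Q x y z} = 3 * card {(x, y, z) \<in> pos_triples n. Q x y z \<and> P x y z}"
proof -
  let ?A = "{(x, y, z) \<in> pos_triples n. Q x y z \<and> P x y z}"
  let ?B = "{(x, y, z) \<in> pos_triples n. Q y z x \<and> P y z x}"
  let ?C = "{(x, y, z) \<in> pos_triples n. Q z x y \<and> P z x y}"
  have rot: "(y, z, x) \<in> pos_triples n" if "(x, y, z) \<in> pos_triples n" for x y z
    using that by (auto simp: pos_triples_def algebra_simps)
  have "{(x, y, z) \<in> pos_triples n. Q x y z} = ?A \<union> (?B \<union> ?C)"
    using ex Q by blast
  then have 1: "card {(x, y, z) \<in> pos_triples n. Q x y z} = card (?A \<union> (?B \<union> ?C))"
    by (rule arg_cong)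
  have 2: "card (?A \<union> (?B \<union> ?C)) = card ?A + card (?B \<union> ?C)"
    using un Q by (intro card_Un_disjoint) auto
  have 3: "card (?B \<union> ?C) = card ?B + card ?C"
  proof (intro card_Un_disjoint finite_pos_triples_sub)
    show "?B \<inter> ?C = {}"
    proof (rule equals0I)
      fix f assume A: "f \<in> ?B \<inter> ?C"
      obtain x y z where "f = (x, y, z)" by (cases f)
      with A have f: "(x, y, z) \<in> pos_triples n" "Q y z x" "P y z x" "P z x y" by simp_all
      \<comment> \<open>Disjointness of the two rotated copies is \<open>un\<close> applied to the
        rotated triple.\<close>
      show False using un[OF rot[OF f(1)] f(2,3)] f(4) by simp
    qed
  qed
  have 4: "card ?B = card ?A"
    by (rule card_pos_triples_rotate[of n "\<lambda>x y z. Q x y z \<and> P x y z"])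
  have 5: "card ?C = card ?B"
    by (rule card_pos_triples_rotate[of n "\<lambda>x y z. Q y z x \<and> P y z x"])
  show ?thesis unfolding 1 2 3 5 4 by simp
qed

section \<open>Class numbers as counts of positive solutions\<close>

lemma sum_obtuse_weights:
  "(\<Sum>(a, b, c)\<in>obtuse_forms N. if b = 0 then 3/2 else 1 :: real) =
     3/2 * card {(a, b, c) \<in> obtuse_forms N. b = 0} + card {(a, b, c) \<in> obtuse_forms N. b \<noteq> 0}"
proof -
  have "(\<Sum>(a, b, c)\<in>obtuse_forms N. if b = 0 then 3/2 else 1 :: real) =
    (\<Sum>f\<in>obtuse_forms N. if fst (snd f) = 0 then 3/2 else 1 :: real)"
    by (intro sum.cong) auto
  also have "\<dots> = 3/2 * card (obtuse_forms N \<inter> {f. fst (snd f) = 0}) + card (obtuse_forms N \<inter> - {f. fst (snd f) = 0})"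
    by (subst sum.If_cases) (auto simp: finite_obtuse_forms)
  also have "obtuse_forms N \<inter> {f. fst (snd f) = 0} = {(a, b, c) \<in> obtuse_forms N. b = 0}" by auto
  also have "obtuse_forms N \<inter> - {f. fst (snd f) = 0} = {(a, b, c) \<in> obtuse_forms N. b \<noteq> 0}" by auto
  finally show ?thesis .
qed

text \<open>For discriminant \<open>-4n\<close> the coefficient \<open>b\<close> is even, so the
  coordinates of an obtuse form are twice a solution for \<open>n\<close>. Forms with
  \<open>b = 0\<close> have \<open>ac = n\<close> and yield the divisor term.\<close>

lemma hurwitz_H_4_pos_triples:
  assumes "n > 0"
  shows "3 * hurwitz_H (4 * n) = card (pos_triples n) + 3/2 * sigma0 n"
proof -
  have "bij_betw (\<lambda>(p, q). (p, 0, q)) (factor_pairs n) {(a, b, c) \<in> obtuse_forms (4 * n). b = 0}"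
    by (rule bij_betw_byWitness[where f' = "\<lambda>(a, b, c). (a, c)"])
       (auto simp: factor_pairs_def obtuse_forms_def)
  then have "card {(a, b, c) \<in> obtuse_forms (4 * n). b = 0} = sigma0 n"
    using card_factor_pairs[OF assms] by (simp add: bij_betw_same_card)
  moreover have "bij_betw (\<lambda>(x, y, z). (x + z, - 2 * z, y + z)) (pos_triples n)
      {(a, b, c) \<in> obtuse_forms (4 * n). b \<noteq> 0}" (is "bij_betw ?f ?A ?B")
  proof (rule bij_betw_imageI)
    show "inj_on ?f ?A" by (auto simp: inj_on_def)
    show "?f ` ?A = ?B"
    proof
      show "?f ` ?A \<subseteq> ?B"
        by (auto simp: pos_triples_def obtuse_forms_def algebra_simps power2_eq_square)
      show "?B \<subseteq> ?f ` ?A"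
      proof
        fix f assume "f \<in> ?B"
        then obtain a b c where f: "f = (a, b, c)" "b < 0" "2 * a + b > 0" "2 * c + b > 0"
          "4 * a * c - b^2 = 4 * int n"
          by (auto simp: obtuse_forms_def)
        then have "b^2 = 4 * (a * c - int n)" by (simp add: algebra_simps)
        then have "even (b^2)" by simp
        then have "even b" by simp
        then obtain m where m: "b = 2 * m" by blast
        have "(a + m, c + m, - m) \<in> ?A"
          using f m by (auto simp: pos_triples_def algebra_simps power2_eq_square)
        moreover have "f = ?f (a + m, c + m, - m)" using f m by simp
        ultimately show "f \<in> ?f ` ?A" by blast
      qed
    qed
  qed
  then have "card {(a, b, c) \<in> obtuse_forms (4 * n). b \<noteq> 0} = card (pos_triples n)"
    by (simp add: bij_betw_same_card)
  ultimately show ?thesis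
    using hurwitz_H_obtuse[of "4 * n"] assms by (simp add: sum_obtuse_weights)
qed

text \<open>As \<open>n\<close> is odd, \<open>b\<close> is odd, so all three coordinates are odd
  and the boundary \<open>z = 0\<close> does not occur. Conversely, odd coordinates give integral
  \<open>a = (x + z)/2\<close> and \<open>c = (y + z)/2\<close>.\<close>

lemma hurwitz_H_odd_pos_triples:
  assumes "n mod 4 = 3"
  shows "3 * hurwitz_H n = card {(x, y, z) \<in> pos_triples n. odd x \<and> odd y \<and> odd z}"
proof -
  have odd_b: "odd b" if "4 * a * c - b^2 = int n" for a b c
  proof -
    have "odd n" using assms by presburger
    moreover have "int n = 4 * a * c - b^2" using that by simp
    ultimately have "odd (4 * a * c - b^2)" by (metis even_of_nat)
    then show ?thesis by simp
  qed
  have "bij_betw (\<lambda>(a, b, c). (2 * a + b, 2 * c + b, - b)) (obtuse_forms n)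
     {(x, y, z) \<in> pos_triples n. odd x \<and> odd y \<and> odd z}" (is "bij_betw ?f ?A ?B")
  proof (rule bij_betw_imageI)
    show "inj_on ?f ?A" by (auto simp: inj_on_def)
    show "?f ` ?A = ?B"
    proof
      show "?f ` ?A \<subseteq> ?B"
      proof
        fix g assume "g \<in> ?f ` ?A"
        then obtain a b c where f: "g = ?f (a, b, c)" "(a, b, c) \<in> ?A" by auto
        then have "4 * a * c - b^2 = int n" by (auto simp: obtuse_forms_def)
        with odd_b have "odd b" by blast
        moreover from this have "b \<noteq> 0" by auto
        ultimately show "g \<in> ?B"
          using f by (auto simp: obtuse_forms_def pos_triples_def algebra_simps power2_eq_square)
      qed
      show "?B \<subseteq> ?f ` ?A"
      proof
        fix g assume "g \<in> ?B"
        then obtain x y z where g: "g = (x, y, z)" "odd x" "odd y" "odd z" "(x, y, z) \<in> pos_triples n"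
          by auto
        then obtain a c where "x + z = 2 * a" "y + z = 2 * c" by (meson evenE odd_even_add)
        then have ac: "x = 2 * a - z" "y = 2 * c - z" by auto
        have "(a, - z, c) \<in> ?A"
          using g unfolding ac by (auto simp: obtuse_forms_def pos_triples_def algebra_simps power2_eq_square)
        moreover have "g = ?f (a, - z, c)" using g ac by simp
        ultimately show "g \<in> ?f ` ?A" by blast
      qed
    qed
  qed
  then have "card (obtuse_forms n) = card {(x, y, z) \<in> pos_triples n. odd x \<and> odd y \<and> odd z}"
    by (rule bij_betw_same_card)
  moreover have "b \<noteq> 0" if "(a, b, c) \<in> obtuse_forms n" for a b c
    using odd_b[of a c b] that by (auto simp: obtuse_forms_def)
  then have zero: "{(a, b, c) \<in> obtuse_forms n. b = 0} = {}"
    and nonzero: "{(a, b, c) \<in> obtuse_forms n. b \<noteq> 0} = obtuse_forms n"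
    by auto
  moreover have "n > 0" using assms by (cases n) auto
  ultimately show ?thesis
    using hurwitz_H_obtuse[of n] assms unfolding sum_obtuse_weights zero nonzero by simp
qed

section \<open>The triples of the theorem as solutions with a parity condition\<close>

text \<open>With \<open>x = 2s\<close>, \<open>y = 2t\<close>, \<open>z = r\<close> the product
  \<open>(x + z)(y + z)\<close> exceeds \<open>xy + yz + zx\<close> by exactly
  \<open>r^2\<close>.\<close>

lemma bij_betw_even_triples:
  "bij_betw (\<lambda>(r, s, t). (2 * int s, 2 * int t, int r)) (even_triples n)
     {(x, y, z) \<in> pos_triples n. even x \<and> even y}" (is "bij_betw ?f ?A ?B")
proof -
  have iff: "(2 * s + r) * (2 * t + r) = n + r^2 \<longleftrightarrow>
      2 * int s * (2 * int t) + 2 * int t * int r + int r * (2 * int s) = int n" for r s t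
    unfolding of_nat_eq_iff[where 'a = int, symmetric] by (simp add: algebra_simps power2_eq_square)
  show ?thesis
  proof (rule bij_betw_imageI)
    show "inj_on ?f ?A" by (auto simp: inj_on_def)
    show "?f ` ?A = ?B"
    proof
      show "?f ` ?A \<subseteq> ?B" by (auto simp: even_triples_def iff pos_triples_def)
      show "?B \<subseteq> ?f ` ?A"
      proof
        fix g assume "g \<in> ?B"
        then obtain x y z where g: "g = (x, y, z)" "even x" "even y" "(x, y, z) \<in> pos_triples n"
          by auto
        then have p: "x > 0" "y > 0" "z > 0" by (auto simp: pos_triples_def)
        have even_pos: "\<exists>s > 0. w = 2 * int s" if "even w" "w > 0" for w
          using that by (intro exI[of _ "nat (w div 2)"]) (auto elim!: evenE)
        obtain r s t where rst: "z = int r" "x = 2 * int s" "y = 2 * int t" "r > 0" "s > 0" "t > 0"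
          using even_pos[OF g(2) p(1)] even_pos[OF g(3) p(2)] zero_less_imp_eq_int[OF p(3)] by blast
        then have "(r, s, t) \<in> ?A" using g by (simp add: even_triples_def iff pos_triples_def)
        then show "g \<in> ?f ` ?A" using g rst by force
      qed
    qed
  qed
qed

lemma bij_betw_odd_triples:
  "bij_betw (\<lambda>(r, s, t). (2 * int s - 1, 2 * int t - 1, int r)) (odd_triples n)
     {(x, y, z) \<in> pos_triples n. odd x \<and> odd y}" (is "bij_betw ?f ?A ?B")
proof -
  have iff: "(2 * s - 1 + r) * (2 * t - 1 + r) = n + r^2 \<longleftrightarrow>
      (2 * int s - 1) * (2 * int t - 1) + (2 * int t - 1) * int r + int r * (2 * int s - 1) = int n"
    if st: "s > 0" "t > 0" for r s t
  proof -
    \<comment> \<open>Writing \<open>s\<close> and \<open>t\<close> as successors removes the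
      natural number subtraction before passing to integers.\<close>
    obtain s' t' where e: "s = Suc s'" "t = Suc t'"
      using gr0_implies_Suc[OF st(1)] gr0_implies_Suc[OF st(2)] by auto
    then have "(2 * s - 1 + r) * (2 * t - 1 + r) = (2 * s' + 1 + r) * (2 * t' + 1 + r)" by simp
    then show ?thesis
      unfolding of_nat_eq_iff[where 'a = int, symmetric] by (simp add: e algebra_simps power2_eq_square)
  qed
  have mem: "(r, s, t) \<in> ?A \<longleftrightarrow> ?f (r, s, t) \<in> pos_triples n" if "r > 0" "s > 0" "t > 0" for r s t
    using that iff[OF that(2,3), of r] by (simp add: odd_triples_def pos_triples_def del: One_nat_def)
  have pos: "r > 0 \<and> s > 0 \<and> t > 0" if "(r, s, t) \<in> ?A" for r s t
    using that by (simp add: odd_triples_def)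
  show ?thesis
  proof (rule bij_betw_imageI)
    show "inj_on ?f ?A" by (auto simp: inj_on_def)
    show "?f ` ?A = ?B"
    proof
      show "?f ` ?A \<subseteq> ?B"
      proof
        fix g assume "g \<in> ?f ` ?A"
        then obtain r s t where g: "g = ?f (r, s, t)" "(r, s, t) \<in> ?A" by auto
        then have "?f (r, s, t) \<in> pos_triples n" using mem[of r s t] pos[of r s t] by simp
        then show "g \<in> ?B" using g by simp
      qed
      show "?B \<subseteq> ?f ` ?A"
      proof
        fix g assume "g \<in> ?B"
        then obtain x y z where g: "g = (x, y, z)" "odd x" "odd y" "(x, y, z) \<in> pos_triples n"
          by auto
        then have p: "x > 0" "y > 0" "z > 0" by (auto simp: pos_triples_def)
        have odd_pos: "\<exists>s > 0. w = 2 * int s - 1" if "odd w" "w > 0" for w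
          using that by (intro exI[of _ "nat ((w + 1) div 2)"]) (auto elim!: oddE)
        obtain r s t where rst: "z = int r" "x = 2 * int s - 1" "y = 2 * int t - 1" "r > 0" "s > 0" "t > 0"
          using odd_pos[OF g(2) p(1)] odd_pos[OF g(3) p(2)] zero_less_imp_eq_int[OF p(3)] by blast
        then have "(r, s, t) \<in> ?A" using g mem by simp
        then show "g \<in> ?f ` ?A" using g rst by force
      qed
    qed
  qed
qed

section \<open>Congruences modulo 4 and 8\<close>

text \<open>Here 4 divides \<open>w(p + q)\<close>, so \<open>pq\<close> is 3 modulo 4 and
  \<open>p\<close>, \<open>q\<close> have different residues. This makes \<open>(q - p)/2\<close>
  odd and excludes \<open>p = q\<close>.\<close>

lemma mod_4_odd_odd_even:
  fixes p q w :: int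
  assumes "odd p" "odd q" "even w" "(p * q + q * w + w * p) mod 4 = 3"
  shows "(q - p) mod 4 = 2"
proof -
  obtain i j k where e: "p = 2 * i + 1" "q = 2 * j + 1" "w = 2 * k"
    using assms by (meson oddE evenE)
  have "p * q + q * w + w * p = 4 * (i * j + k * (i + j + 1)) + 2 * (i + j) + 1"
    unfolding e by algebra
  then have "(4 * (i * j + k * (i + j + 1)) + 2 * (i + j) + 1) mod 4 = 3" using assms by simp
  then have "(2 * j - 2 * i) mod 4 = 2" by presburger
  then show ?thesis by (simp add: e)
qed

text \<open>With \<open>x = 2i + 1\<close>, \<open>y = 2j + 1\<close>, \<open>z = 2k + 1\<close> the
  sum is \<open>4E + 3\<close>, where \<open>E\<close> is even exactly if \<open>i\<close>,
  \<open>j\<close>, \<open>k\<close> have the same parity. So residue 3 makes all three entries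
  congruent modulo 4, and residue 7 makes exactly one pair congruent.\<close>

lemma mod_8_odd_odd_odd:
  fixes x y z :: int
  assumes "odd x" "odd y" "odd z"
  defines "S \<equiv> x * y + y * z + z * x"
  shows "S mod 8 = 3 \<Longrightarrow> 4 dvd x - z"
    and "S mod 8 = 7 \<Longrightarrow> 4 dvd x - z \<or> 4 dvd y - x \<or> 4 dvd z - y"
    and "S mod 8 = 7 \<Longrightarrow> 4 dvd x - z \<Longrightarrow> \<not> 4 dvd y - x \<and> \<not> 4 dvd z - y"
proof -
  obtain i j k where e: "x = 2 * i + 1" "y = 2 * j + 1" "z = 2 * k + 1"
    using assms by (meson oddE)
  define E where "E = i * j + j * k + k * i + i + j + k"
  have S: "S = 4 * E + 3" unfolding S_def E_def e by algebra
  have "4 dvd x - z \<longleftrightarrow> even (i - k)" "4 dvd y - x \<longleftrightarrow> even (j - i)" "4 dvd z - y \<longleftrightarrow> even (k - j)"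
    unfolding e by presburger+
  moreover have "S mod 8 = 3 \<longleftrightarrow> even E" "S mod 8 = 7 \<longleftrightarrow> odd E" unfolding S by presburger+
  ultimately show "S mod 8 = 3 \<Longrightarrow> 4 dvd x - z"
    and "S mod 8 = 7 \<Longrightarrow> 4 dvd x - z \<or> 4 dvd y - x \<or> 4 dvd z - y"
    and "S mod 8 = 7 \<Longrightarrow> 4 dvd x - z \<Longrightarrow> \<not> 4 dvd y - x \<and> \<not> 4 dvd z - y"
    by (auto simp: E_def)
qed

lemma mod_4_same_parity:
  fixes x y z :: int
  assumes "even x \<longleftrightarrow> even y" "even y \<longleftrightarrow> even z"
  shows "(x * y + y * z + z * x) mod 4 \<in> {0, 3}"
proof (cases "even x")
  case True
  then obtain i j k where e: "x = 2 * i" "y = 2 * j" "z = 2 * k"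
    using assms by (meson evenE)
  have "x * y + y * z + z * x = 4 * (i * j + j * k + k * i)" unfolding e by algebra
  then show ?thesis by simp
next
  case False
  then obtain i j k where e: "x = 2 * i + 1" "y = 2 * j + 1" "z = 2 * k + 1"
    using assms by (meson oddE)
  have "x * y + y * z + z * x = 4 * (i * j + j * k + k * i + i + j + k) + 3"
    (is "_ = 4 * ?M + 3") unfolding e by algebra
  moreover have "(4 * m + 3) mod 4 = 3" for m :: int by presburger
  ultimately have "(x * y + y * z + z * x) mod 4 = 3" by metis
  then show ?thesis by simp
qed

section \<open>Counting solutions by parity\<close>

text \<open>The three entries cannot all have the same parity, so exactly one of the three pairs
  does, and the count is a third of all solutions.\<close>

lemma card_same_parity_triples:
  assumes "n mod 4 = 1 \<or> n mod 4 = 2"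
  shows "card {(x, y, z) \<in> pos_triples n. even x = even y} = hurwitz_H (4 * n) - 1/2 * sigma0 n"
proof -
  have ne: "\<not> ((even x \<longleftrightarrow> even y) \<and> (even y \<longleftrightarrow> even z))" if "(x, y, z) \<in> pos_triples n" for x y z
  proof
    assume "(even x \<longleftrightarrow> even y) \<and> (even y \<longleftrightarrow> even z)"
    then have "(x * y + y * z + z * x) mod 4 \<in> {0, 3}" using mod_4_same_parity by blast
    then have "int n mod 4 \<in> {0, 3}" using that by (auto simp: pos_triples_def)
    moreover have "int n mod 4 = int (n mod 4)" by (simp add: zmod_int)
    ultimately show False using assms by auto
  qed
  have "card {(x, y, z) \<in> pos_triples n. True} = 3 * card {(x, y, z) \<in> pos_triples n. True \<and> (even x = even y)}"
    by (rule card_pos_triples_rotations) (use ne in blast)+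
  moreover have "{(x, y, z) \<in> pos_triples n. True} = pos_triples n" by auto
  moreover have "n > 0" using assms by (cases n) auto
  ultimately show ?thesis using hurwitz_H_4_pos_triples[of n] by simp
qed

lemma card_pos_triples_trichotomy:
  "card {(x, y, z) \<in> pos_triples n. Q x y z} =
    card {(x, y, z) \<in> pos_triples n. Q x y z \<and> x < z} +
    card {(x, y, z) \<in> pos_triples n. Q x y z \<and> x > z} +
    card {(x, y, z) \<in> pos_triples n. Q x y z \<and> x = z}"
  (is "card ?S = card ?A + card ?B + card ?C")
proof -
  have "?S = ?A \<union> ?B \<union> ?C" by auto
  then have "card ?S = card (?A \<union> ?B \<union> ?C)" by (rule arg_cong)
  moreover have "card (?A \<union> ?B \<union> ?C) = card (?A \<union> ?B) + card ?C"
    by (intro card_Un_disjoint finite_UnI finite_pos_triples_sub) auto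
  moreover have "card (?A \<union> ?B) = card ?A + card ?B"
    by (intro card_Un_disjoint finite_pos_triples_sub) auto
  ultimately show ?thesis by (simp only:)
qed

text \<open>The map \<open>(x, y, z) \<mapsto> (x, 2y + x, (z - x)/2)\<close> preserves the
  quadratic expression. It matches the part \<open>x < z\<close> with the solutions having
  \<open>p < q\<close>, and the diagonal \<open>x = z\<close> with the factorizations
  \<open>pq = n\<close>, \<open>p < q\<close>. Exchanging entries doubles each of these parts except
  the diagonal, which accounts for the factors 2.\<close>

lemma card_odd_triples_congruent:
  assumes "n mod 4 = 3"
  shows "2 * card {(x, y, z) \<in> pos_triples n. odd x \<and> odd y \<and> odd z \<and> 4 dvd x - z}
    = 2 * card {(p, q, w) \<in> pos_triples n. odd p \<and> odd q \<and> even w} + sigma0 n"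
proof -
  have n: "n > 0" "odd n" "int n mod 4 = 3" using assms by (presburger+)
  let ?A = "\<lambda>R. {(x, y, z) \<in> pos_triples n. (odd x \<and> odd y \<and> odd z \<and> 4 dvd x - z) \<and> R x z}"
  let ?P = "\<lambda>R. {(p, q, w) \<in> pos_triples n. odd p \<and> odd q \<and> even w \<and> R p q}"
  let ?D = "\<lambda>R. {(p, q) \<in> factor_pairs n. R p q}"
  have swapA: "card (?A (\<lambda>x z. x > z)) = card (?A (<))"
    by (rule bij_betw_same_card[of "\<lambda>(x, y, z). (z, y, x)"],
        rule bij_betw_byWitness[where f' = "\<lambda>(x, y, z). (z, y, x)"])
       (auto simp: pos_triples_def algebra_simps dvd_diff_commute)
  have swapP: "card (?P (\<lambda>x z. x > z)) = card (?P (<))"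
    by (rule bij_betw_same_card[of "\<lambda>(x, y, z). (y, x, z)"],
        rule bij_betw_byWitness[where f' = "\<lambda>(x, y, z). (y, x, z)"])
       (auto simp: pos_triples_def algebra_simps)
  have swapD: "card (?D (\<lambda>x z. x > z)) = card (?D (<))"
    by (rule bij_betw_same_card[of "\<lambda>(x, y). (y, x)"],
        rule bij_betw_byWitness[where f' = "\<lambda>(x, y). (y, x)"])
       (auto simp: factor_pairs_def algebra_simps)
  have P_mod: "(q - p) mod 4 = 2" if "(p, q, w) \<in> pos_triples n" "odd p" "odd q" "even w" for p q w
    using mod_4_odd_odd_even[of p q w] that n by (auto simp: pos_triples_def)
  have D_odd: "odd p \<and> odd q" if "(p, q) \<in> factor_pairs n" for p q
  proof -
    have "odd (int n)" using n by simp
    moreover have "int n = p * q" using that by (auto simp: factor_pairs_def)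
    ultimately show ?thesis by simp
  qed
  have D_mod: "(q - p) mod 4 = 2" if "(p, q) \<in> factor_pairs n" for p q
    using mod_4_odd_odd_even[of p q 0] D_odd that n by (auto simp: factor_pairs_def)
  have finD: "finite (?D R)" for R
    by (rule finite_subset[OF _ finite_factor_pairs[OF n(1)]]) auto
  have "bij_betw (\<lambda>(x, y, z). (x, 2 * y + x, (z - x) div 2)) (?A (<)) (?P (<))" (is "bij_betw ?f _ _")
  \<comment> \<open>The side conditions correspond: \<open>w\<close> is even because 4 divides
    \<open>z - x\<close>, and \<open>y = (q - p)/2\<close> is odd because \<open>q - p\<close> is 2
    modulo 4.\<close>
  proof (rule bij_betw_byWitness[where f' = "\<lambda>(p, q, w). (p, (q - p) div 2, p + 2 * w)"])
    show "?f ` ?A (<) \<subseteq> ?P (<)"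
    proof
      fix g assume "g \<in> ?f ` ?A (<)"
      then obtain x y z where g: "g = ?f (x, y, z)" "(x, y, z) \<in> ?A (<)" by auto
      then have "4 dvd z - x" by (simp add: dvd_diff_commute)
      then obtain k where "z - x = 4 * k" ..
      then have k: "z = x + 4 * k" by simp
      show "g \<in> ?P (<)" using g unfolding k by (auto simp: pos_triples_def algebra_simps)
    qed
    show "(\<lambda>(p, q, w). (p, (q - p) div 2, p + 2 * w)) ` ?P (<) \<subseteq> ?A (<)" (is "?g ` _ \<subseteq> _")
    proof
      fix g assume "g \<in> ?g ` ?P (<)"
      then obtain p q w where g: "g = ?g (p, q, w)" "(p, q, w) \<in> ?P (<)" by auto
      then have "(q - p) mod 4 = 2" using P_mod by blast
      then have "q = p + 4 * ((q - p) div 4) + 2" using div_mult_mod_eq[of "q - p" 4] by linarith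
      then obtain m where m: "q = p + 4 * m + 2" by blast
      obtain k where k: "w = 2 * k" using g by auto
      have "(q - p) div 2 = 2 * m + 1" unfolding m by simp
      then show "g \<in> ?A (<)" using g unfolding m k by (auto simp: pos_triples_def algebra_simps)
    qed
    show "\<forall>a\<in>?A (<). ?g (?f a) = a" by auto
    show "\<forall>a\<in>?P (<). ?f (?g a) = a" by auto
  qed
  then have 1: "card (?A (<)) = card (?P (<))" by (rule bij_betw_same_card)
  \<comment> \<open>The same map on the diagonal, where \<open>w = 0\<close>.\<close>
  have "bij_betw (\<lambda>(x, y, z). (x, 2 * y + x)) (?A (=)) (?D (<))" (is "bij_betw ?f _ _")
  proof (rule bij_betw_byWitness[where f' = "\<lambda>(p, q). (p, (q - p) div 2, p)"])
    show "?f ` ?A (=) \<subseteq> ?D (<)" by (auto simp: pos_triples_def factor_pairs_def algebra_simps)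
    show "(\<lambda>(p, q). (p, (q - p) div 2, p)) ` ?D (<) \<subseteq> ?A (=)" (is "?g ` _ \<subseteq> _")
    proof
      fix g assume "g \<in> ?g ` ?D (<)"
      then obtain p q where g: "g = ?g (p, q)" "(p, q) \<in> ?D (<)" by auto
      then have "(q - p) mod 4 = 2" and o: "odd p" using D_mod D_odd by blast+
      then have "q = p + 4 * ((q - p) div 4) + 2" using div_mult_mod_eq[of "q - p" 4] by linarith
      then obtain m where m: "q = p + 4 * m + 2" by blast
      have "(q - p) div 2 = 2 * m + 1" unfolding m by simp
      then show "g \<in> ?A (=)" using g o unfolding m
        by (auto simp: pos_triples_def factor_pairs_def algebra_simps)
    qed
    show "\<forall>a\<in>?A (=). ?g (?f a) = a" by auto
    show "\<forall>a\<in>?D (<). ?f (?g a) = a"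
    proof
      fix f assume "f \<in> ?D (<)"
      then obtain p q where f: "f = (p, q)" "(p, q) \<in> factor_pairs n" by auto
      then have "even (q - p)" using D_odd by auto
      then show "?f (?g f) = f" using f by auto
    qed
  qed
  then have 2: "card (?A (=)) = card (?D (<))" by (rule bij_betw_same_card)
  have "card {(x, y, z) \<in> pos_triples n. odd x \<and> odd y \<and> odd z \<and> 4 dvd x - z} =
     card (?A (<)) + card (?A (\<lambda>x z. x > z)) + card (?A (=))"
    by (rule card_pos_triples_trichotomy)
  then have A: "card {(x, y, z) \<in> pos_triples n. odd x \<and> odd y \<and> odd z \<and> 4 dvd x - z} =
     2 * card (?P (<)) + card (?D (<))"
    unfolding swapA 1 2 by (simp only: mult_2)
  have "{(p, q, w) \<in> pos_triples n. odd p \<and> odd q \<and> even w} = ?P (<) \<union> ?P (\<lambda>x z. x > z)"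
  proof -
    have "p < q \<or> q < p" if "(p, q, w) \<in> pos_triples n" "odd p" "odd q" "even w" for p q w
      using P_mod[OF that] by (cases p q rule: linorder_cases) auto
    then show ?thesis by blast
  qed
  then have "card {(p, q, w) \<in> pos_triples n. odd p \<and> odd q \<and> even w} = card (?P (<) \<union> ?P (\<lambda>x z. x > z))"
    by (rule arg_cong)
  moreover have "card (?P (<) \<union> ?P (\<lambda>x z. x > z)) = card (?P (<)) + card (?P (\<lambda>x z. x > z))"
    by (rule card_Un_disjoint) auto
  ultimately have P: "card {(p, q, w) \<in> pos_triples n. odd p \<and> odd q \<and> even w} = 2 * card (?P (<))"
    unfolding swapP by (simp only: mult_2)
  \<comment> \<open>No factorization has \<open>p = q\<close>, since the factors differ modulo
    4.\<close>
  have "factor_pairs n = ?D (<) \<union> ?D (\<lambda>x z. x > z)"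
  proof -
    have "p < q \<or> q < p" if "(p, q) \<in> factor_pairs n" for p q
      using D_mod[OF that] by (cases p q rule: linorder_cases) auto
    then show ?thesis by blast
  qed
  then have "card (factor_pairs n) = card (?D (<) \<union> ?D (\<lambda>x z. x > z))" by (rule arg_cong)
  moreover have "card (?D (<) \<union> ?D (\<lambda>x z. x > z)) = card (?D (<)) + card (?D (\<lambda>x z. x > z))"
    by (rule card_Un_disjoint) (use finD in auto)
  ultimately have "sigma0 n = 2 * card (?D (<))"
    unfolding swapD card_factor_pairs[OF n(1)] by (simp only: mult_2)
  then show ?thesis unfolding A P by simp
qed

text \<open>The divisors of \<open>2m\<close> are those of \<open>m\<close>, all odd, and their
  doubles. This turns half of \<open>sigma0 n\<close> into \<open>sigma0 (n div 2)\<close> when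
  \<open>n\<close> is 2 modulo 4.\<close>

lemma sigma0_double_odd:
  assumes "odd m"
  shows "sigma0 (2 * m) = 2 * sigma0 m"
proof -
  have m: "m > 0" using assms by (cases m) auto
  have "{d. d dvd 2 * m} = {d. d dvd m} \<union> (\<lambda>d. 2 * d) ` {d. d dvd m}"
  proof (intro equalityI subsetI)
    fix d assume "d \<in> {d. d dvd 2 * m}"
    then have d: "d dvd 2 * m" by simp
    show "d \<in> {d. d dvd m} \<union> (\<lambda>d. 2 * d) ` {d. d dvd m}"
    proof (cases "even d")
      case True
      then show ?thesis using d by auto
    next
      case False
      then have "coprime d 2" by simp
      then show ?thesis using d by (simp add: coprime_dvd_mult_right_iff)
    qed
  qed auto
  moreover have "{d. d dvd m} \<inter> (\<lambda>d. 2 * d) ` {d. d dvd m} = {}" using assms by auto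
  ultimately show ?thesis using m
    by (simp add: sigma0_def card_Un_disjoint card_image inj_on_def)
qed

section \<open>The four residue classes\<close>

theorem theorem6p1:
  fixes n :: nat
  assumes "n > 0"
  shows "(n mod 4 = 2 \<longrightarrow>
            real (card (even_triples n)) = hurwitz_H (4 * n) - real (sigma0 (n div 2))) \<and>
         (n mod 4 = 1 \<longrightarrow>
            real (card (odd_triples n)) = hurwitz_H (4 * n) - 1/2 * real (sigma0 n)) \<and>
         (n mod 8 = 3 \<longrightarrow>
            real (card (odd_triples n)) = 6 * hurwitz_H n - 1/2 * real (sigma0 n)) \<and>
         (n mod 8 = 7 \<longrightarrow>
            (\<Sum>(r, s, t)\<in>odd_triples n. (-1) ^ (r + s + t)) = 1/2 * real (sigma0 n))"
proof (intro conjI impI)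
  assume n: "n mod 4 = 2"
  \<comment> \<open>Two odd entries \<open>x\<close>, \<open>y\<close> would make
    \<open>xy + z(x + y)\<close> odd.\<close>
  have "even y" if "(x, y, z) \<in> pos_triples n" "even x = even y" for x y z
  proof -
    have "even (int n)" using n by presburger
    moreover have "int n = x * y + y * z + z * x" using that by (auto simp: pos_triples_def)
    ultimately show ?thesis using that(2) by auto
  qed
  then have "{(x, y, z) \<in> pos_triples n. even x \<and> even y} = {(x, y, z) \<in> pos_triples n. even x = even y}"
    by blast
  then have "real (card (even_triples n)) = hurwitz_H (4 * n) - 1/2 * sigma0 n"
    using bij_betw_same_card[OF bij_betw_even_triples[of n]] card_same_parity_triples[of n] n by simp
  moreover have "sigma0 n = 2 * sigma0 (n div 2)"
  proof -
    have "odd (n div 2)" "2 * (n div 2) = n" using n by presburger+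
    then show ?thesis using sigma0_double_odd[of "n div 2"] by simp
  qed
  ultimately show "real (card (even_triples n)) = hurwitz_H (4 * n) - real (sigma0 (n div 2))" by simp
next
  assume n: "n mod 4 = 1"
  have "odd y" if "(x, y, z) \<in> pos_triples n" "even x = even y" for x y z
  proof -
    have "odd (int n)" using n by presburger
    moreover have "int n = x * y + y * z + z * x" using that by (auto simp: pos_triples_def)
    ultimately show ?thesis using that(2) by auto
  qed
  then have "{(x, y, z) \<in> pos_triples n. odd x \<and> odd y} = {(x, y, z) \<in> pos_triples n. even x = even y}"
    by blast
  then show "real (card (odd_triples n)) = hurwitz_H (4 * n) - 1/2 * real (sigma0 n)"
    using bij_betw_same_card[OF bij_betw_odd_triples[of n]] card_same_parity_triples[of n] n by simp
next
  let ?P = "{(x, y, z) \<in> pos_triples n. odd x \<and> odd y \<and> even z}"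
  let ?A = "{(x, y, z) \<in> pos_triples n. odd x \<and> odd y \<and> odd z}"
  assume n: "n mod 8 = 3"
  then have n4: "n mod 4 = 3" "int n mod 8 = 3" by presburger+
  \<comment> \<open>For residue 3 the congruence condition is automatic, so
    \<open>2|A| = 2|P| + sigma0 n\<close> and the count is
    \<open>|A| + |P| = 2|A| - sigma0 n / 2\<close>, with \<open>|A| = 3 H(n)\<close>.\<close>
  have "4 dvd x - z" if "(x, y, z) \<in> pos_triples n" "odd x" "odd y" "odd z" for x y z
    using mod_8_odd_odd_odd(1)[OF that(2-4)] that(1) n4 by (auto simp: pos_triples_def)
  then have "?A = {(x, y, z) \<in> pos_triples n. odd x \<and> odd y \<and> odd z \<and> 4 dvd x - z}" by blast
  then have "2 * card ?A = 2 * card ?P + sigma0 n"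
    using card_odd_triples_congruent[OF n4(1)] by simp
  moreover have "{(x, y, z) \<in> pos_triples n. odd x \<and> odd y} = ?A \<union> ?P" by blast
  then have "card (odd_triples n) = card (?A \<union> ?P)"
    using bij_betw_same_card[OF bij_betw_odd_triples[of n]] by simp
  then have "card (odd_triples n) = card ?A + card ?P"
    by (subst (asm) card_Un_disjoint) auto
  ultimately show "real (card (odd_triples n)) = 6 * hurwitz_H n - 1/2 * real (sigma0 n)"
    using hurwitz_H_odd_pos_triples[OF n4(1)] by simp
next
  let ?P = "{(x, y, z) \<in> pos_triples n. odd x \<and> odd y \<and> even z}"
  let ?Q = "\<lambda>x y z :: int. odd x \<and> odd y \<and> odd z"
  let ?A = "{(x, y, z) \<in> pos_triples n. ?Q x y z}"
  let ?B = "{(x, y, z) \<in> pos_triples n. ?Q x y z \<and> 4 dvd x - z}"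
  \<comment> \<open>\<open>?C\<close> is \<open>?B\<close> rotated, so that its condition concerns
    \<open>y - x = 2(t - s)\<close>, which governs the sign.\<close>
  let ?C = "{(x, y, z) \<in> pos_triples n. ?Q y z x \<and> 4 dvd y - x}"
  let ?D = "{(x, y, z) \<in> pos_triples n. ?Q y z x \<and> \<not> 4 dvd y - x}"
  assume n: "n mod 8 = 7"
  have "n mod 8 mod 4 = n mod 4" by (rule mod_mod_cancel) simp
  then have n4: "n mod 4 = 3" using n by simp
  have n8: "int n mod 8 = 7" using n zmod_int[of n 8] by simp
  have n4': "int n mod 4 = 3" using n4 zmod_int[of n 4] by simp
  \<comment> \<open>The sign \<open>(-1)^(r+s+t)\<close> in the coordinates
    \<open>x = 2s - 1\<close>, \<open>y = 2t - 1\<close>, \<open>z = r\<close>. If \<open>r\<close>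
    is even, \<open>s + t\<close> must be odd; if \<open>r\<close> is odd, the sign is -1 exactly
    when \<open>s + t\<close> is even, that is when 4 divides \<open>y - x\<close>.\<close>
  let ?g = "\<lambda>(x :: int, y, z). if even z \<or> 4 dvd y - x then -1 else 1 :: real"
  have sign: "(-1) ^ (r + s + t) = ?g (2 * int s - 1, 2 * int t - 1, int r)"
    if "(r, s, t) \<in> odd_triples n" for r s t
  proof -
    have mem: "(2 * int s - 1, 2 * int t - 1, int r) \<in> pos_triples n"
      using bij_betwE[OF bij_betw_odd_triples[of n]] that by fastforce
    have 4: "(2 * b - 1 - (2 * a - 1)) mod 4 = (if even (a + b) then 0 else 2)" for a b :: int
      by presburger
    have "odd (s + t)" if "even r"
    proof -
      have "(2 * int t - 1 - (2 * int s - 1)) mod 4 = 2"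
        using mem that n4' by (intro mod_4_odd_odd_even[of _ _ "int r"]) (auto simp: pos_triples_def)
      then have "odd (int s + int t)" unfolding 4 by (simp split: if_splits)
      then show ?thesis by simp
    qed
    moreover have "4 dvd 2 * int t - 1 - (2 * int s - 1) \<longleftrightarrow> even (s + t)"
      unfolding dvd_eq_mod_eq_0[of 4] 4 by simp
    ultimately show ?thesis by (cases "even r") (auto simp: minus_one_power_iff)
  qed
  have "(\<Sum>(r, s, t)\<in>odd_triples n. (-1) ^ (r + s + t)) =
      (\<Sum>f\<in>odd_triples n. ?g ((\<lambda>(r, s, t). (2 * int s - 1, 2 * int t - 1, int r)) f))"
    by (rule sum.cong) (use sign in auto)
  also have "\<dots> = sum ?g {(x, y, z) \<in> pos_triples n. odd x \<and> odd y}"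
    by (rule sum.reindex_bij_betw[OF bij_betw_odd_triples])
  finally have 1: "(\<Sum>(r, s, t)\<in>odd_triples n. (-1) ^ (r + s + t)) =
    sum ?g {(x, y, z) \<in> pos_triples n. odd x \<and> odd y}" .
  have 2: "{(x, y, z) \<in> pos_triples n. odd x \<and> odd y} = ?P \<union> (?C \<union> ?D)" by blast
  have 3: "sum ?g (?P \<union> (?C \<union> ?D)) = sum ?g ?P + sum ?g (?C \<union> ?D)"
    by (rule sum.union_disjoint) auto
  have 4: "sum ?g (?C \<union> ?D) = sum ?g ?C + sum ?g ?D"
    by (rule sum.union_disjoint) auto
  have 5: "sum ?g ?P = (\<Sum>f\<in>?P. -1)" by (rule sum.cong) auto
  have 6: "sum ?g ?C = (\<Sum>f\<in>?C. -1)" by (rule sum.cong) auto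
  have 7: "sum ?g ?D = (\<Sum>f\<in>?D. 1)" by (rule sum.cong) auto
  have sum: "(\<Sum>(r, s, t)\<in>odd_triples n. (-1) ^ (r + s + t)) = real (card ?D) - card ?C - card ?P"
    unfolding 1 2 3 4 5 6 7 by simp
  \<comment> \<open>Exactly one pair is congruent modulo 4, so \<open>|C| = |B|\<close> and
    \<open>|D| = 2|B|\<close>. The signed sum is therefore \<open>|B| - |P|\<close>, half of
    \<open>sigma0 n\<close>.\<close>
  have "card ?A = 3 * card ?B"
  proof (rule card_pos_triples_rotations)
    fix x y z assume "(x, y, z) \<in> pos_triples n" and q: "?Q x y z"
    then have "(x * y + y * z + z * x) mod 8 = 7" using n8 by (auto simp: pos_triples_def)
    then show "4 dvd x - z \<or> 4 dvd y - x \<or> 4 dvd z - y"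
      and "4 dvd x - z \<Longrightarrow> \<not> 4 dvd y - x \<and> \<not> 4 dvd z - y"
      using mod_8_odd_odd_odd(2,3)[of x y z] q by simp_all
  qed blast
  moreover have "card ?C = card ?B"
    by (rule card_pos_triples_rotate[of n "\<lambda>x y z. ?Q x y z \<and> 4 dvd x - z"])
  moreover have "?A = ?C \<union> ?D" by blast
  then have "card ?A = card (?C \<union> ?D)" by simp
  then have "card ?A = card ?C + card ?D"
    by (subst (asm) card_Un_disjoint) auto
  moreover have "2 * card ?B = 2 * card ?P + sigma0 n"
    using card_odd_triples_congruent[OF n4] by simp
  ultimately show "(\<Sum>(r, s, t)\<in>odd_triples n. (-1) ^ (r + s + t)) = 1/2 * real (sigma0 n)"
    unfolding sum by linarith
qed

end
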